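(* Let $V\subseteq\mathbb A^n$ be an affine variety defined over $\mathbb Q$ by homogeneous equations, with $V(\mathbb Q)\cap\mathbb Q_{>0}^n$ nonempty, let $\mathscr Y_V$ be its rational-ray visibility datum, and let $P=(P_1,\dots,P_n)\in\mathcal B(\mathscr Y_V)$. Then $P$ is globally visible if and only if $\gcd(P_1,\dots,P_n)=1$. For every prime $p$, the point $P$ is $p$-adically visible if and only if $p$ does not divide all of the coordinates $P_i$. In particular, visibility is locally detectable for $\mathscr Y_V$: a point of $\mathcal B(\mathscr Y_V)$ is globally visible if and only if it is $p$-adically visible for every prime $p$.
   Context: Rational-ray datum: for every class $[v]\in(V(\mathbb Q)\cap\mathbb Q_{>0}^n)/\mathbb Q_{>0}$ (positive rational rays) choose a representative $v$ and define the ordered branch $\phi_{[v]}(t)=tv$, $t>0$. $\mathscr Y_V$ is the collection of these branches. Its branch locus $\mathcal B(\mathscr Y_V)$ is the set of integral points on the branches, which equals $V(\mathbb Z)\cap\mathbb Z_{>0}^n$. For $P\in\mathbb Z^n$ and a prime $p$, $v_p(P)=\min_iv_p(P_i)$. A branch point $\phi_{[v]}(t)$ is globally visible if there is no real $s$ with $0<s<t$ and $\phi_{[v]}(s)\in\mathbb Z^n$; it is $p$-adically visible if $v_p(\phi_{[v]}(t))\le v_p(\phi_{[v]}(s))$ for every real $s$ with $0<s<t$ and $\phi_{[v]}(s)\in\mathbb Z^n$. *)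

theory Defs
  imports "HOL-Analysis.Analysis" "HOL-Library.Poly_Mapping"
begin

text \<open>Polynomials over the rationals in variables indexed by a finite type \<open>'n\<close>, which plays the
  role of \<open>{1, \<dots>, n}\<close>: a monomial is its exponent vector, a polynomial the
  finitely supported map from monomials to coefficients.\<close>

type_synonym 'n rat_mpoly = "('n \<Rightarrow>\<^sub>0 nat) \<Rightarrow>\<^sub>0 rat"

definition eval_mpoly :: "'n::finite rat_mpoly \<Rightarrow> rat ^ 'n \<Rightarrow> rat" where
  "eval_mpoly f x =
     (\<Sum>m\<in>Poly_Mapping.keys f. Poly_Mapping.lookup f m * (\<Prod>i\<in>UNIV. (x $ i) ^ Poly_Mapping.lookup m i))"

definition homogeneous :: "'n::finite rat_mpoly \<Rightarrow> bool" where
  "homogeneous f \<longleftrightarrow> (\<exists>d. \<forall>m\<in>Poly_Mapping.keys f. (\<Sum>i\<in>UNIV. Poly_Mapping.lookup m i) = d)"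

text \<open>A variety \<open>V\<close> over the rationals enters through a set \<open>E\<close> of defining equations;
  \<open>rational_points E\<close> is then \<open>V(\<rat>)\<close>.\<close>

definition rational_points :: "'n::finite rat_mpoly set \<Rightarrow> (rat ^ 'n) set" where
  "rational_points E = {x. \<forall>f\<in>E. eval_mpoly f x = 0}"

definition positive_rational_points :: "'n::finite rat_mpoly set \<Rightarrow> (rat ^ 'n) set" where
  "positive_rational_points E = rational_points E \<inter> {x. \<forall>i. 0 < x $ i}"

definition ray_rel :: "'n::finite rat_mpoly set \<Rightarrow> ((rat ^ 'n) \<times> (rat ^ 'n)) set" where
  "ray_rel E = {(v, w). v \<in> positive_rational_points E \<and> w \<in> positive_rational_points E
                        \<and> (\<exists>q>0. w = q *s v)}"

definition positive_rational_rays :: "'n::finite rat_mpoly set \<Rightarrow> (rat ^ 'n) set set" where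
  "positive_rational_rays E = positive_rational_points E // ray_rel E"

definition chooses_representatives ::
    "'n::finite rat_mpoly set \<Rightarrow> ((rat ^ 'n) set \<Rightarrow> rat ^ 'n) \<Rightarrow> bool" where
  "chooses_representatives E rep \<longleftrightarrow> (\<forall>c\<in>positive_rational_rays E. rep c \<in> c)"

definition real_of_rat_vec :: "rat ^ 'n \<Rightarrow> real ^ 'n" where
  "real_of_rat_vec v = (\<chi> i. of_rat (v $ i))"

definition real_of_int_vec :: "int ^ 'n \<Rightarrow> real ^ 'n" where
  "real_of_int_vec P = (\<chi> i. of_int (P $ i))"

text \<open>An ordered branch is a map on the positive reals; it is represented by a total function on
  the reals, of which only the values at positive parameters are ever used.\<close>

definition branch :: "rat ^ 'n \<Rightarrow> real \<Rightarrow> real ^ 'n" where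
  "branch v t = t *\<^sub>R real_of_rat_vec v"

definition rational_ray_datum ::
    "'n::finite rat_mpoly set \<Rightarrow> ((rat ^ 'n) set \<Rightarrow> rat ^ 'n) \<Rightarrow> (real \<Rightarrow> real ^ 'n) set" where
  "rational_ray_datum E rep = (\<lambda>c. branch (rep c)) ` positive_rational_rays E"

definition branch_locus :: "(real \<Rightarrow> real ^ 'n) set \<Rightarrow> (int ^ 'n) set" where
  "branch_locus Y = {P. \<exists>\<phi>\<in>Y. \<exists>t>0. \<phi> t = real_of_int_vec P}"

text \<open>The \<open>p\<close>-adic valuation, with value \<open>\<infinity>\<close> at 0 (where the library's
  \<^const>\<open>multiplicity\<close> is 0).\<close>

definition val :: "nat \<Rightarrow> int \<Rightarrow> enat" where
  "val p a = (if a = 0 then \<infinity> else enat (multiplicity (int p) a))"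

definition vec_val :: "nat \<Rightarrow> int ^ 'n::finite \<Rightarrow> enat" where
  "vec_val p P = (MIN i\<in>UNIV. val p (P $ i))"

definition globally_visible :: "(real \<Rightarrow> real ^ 'n) set \<Rightarrow> int ^ 'n \<Rightarrow> bool" where
  "globally_visible Y P \<longleftrightarrow>
     (\<exists>\<phi>\<in>Y. \<exists>t>0. \<phi> t = real_of_int_vec P \<and>
        \<not> (\<exists>s. 0 < s \<and> s < t \<and> (\<exists>Q. \<phi> s = real_of_int_vec Q)))"

definition padically_visible :: "nat \<Rightarrow> (real \<Rightarrow> real ^ 'n::finite) set \<Rightarrow> int ^ 'n \<Rightarrow> bool" where
  "padically_visible p Y P \<longleftrightarrow>
     (\<exists>\<phi>\<in>Y. \<exists>t>0. \<phi> t = real_of_int_vec P \<and>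
        (\<forall>s Q. 0 < s \<and> s < t \<and> \<phi> s = real_of_int_vec Q \<longrightarrow> vec_val p P \<le> vec_val p Q))"

definition locally_detectable :: "(real \<Rightarrow> real ^ 'n::finite) set \<Rightarrow> bool" where
  "locally_detectable Y \<longleftrightarrow>
     (\<forall>P\<in>branch_locus Y. globally_visible Y P \<longleftrightarrow> (\<forall>p. prime p \<longrightarrow> padically_visible p Y P))"

end

theory Submission
  imports Defs
begin

text \<open>All branches are rays through the origin, so if a branch passes through \<open>P\<close>, the points before
  \<open>P\<close> on it are exactly the multiples \<open>r P\<close> with \<open>0 < r < 1\<close>. Both kinds of visibility therefore
  depend only on the integral points among these multiples, whichever branch through \<open>P\<close> and
  whichever parametrisation of it is used (\<open>globally_visible_iff\<close>, \<open>padically_visible_iff\<close>).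

  Let \<open>g\<close> be the gcd of the coordinates of \<open>P\<close>, which are positive. If \<open>g > 1\<close>, then \<open>P / g\<close> is an
  integral point that hides \<open>P\<close>. If \<open>g = 1\<close> and \<open>Q = r P\<close> is integral, then comparing coordinates
  gives \<open>Q\<^sub>i P\<^sub>k = Q\<^sub>k P\<^sub>i\<close>; so \<open>P\<^sub>k\<close> divides every \<open>Q\<^sub>k P\<^sub>i\<close>, hence their gcd \<open>Q\<^sub>k\<close>, which
  contradicts \<open>0 < Q\<^sub>k < P\<^sub>k\<close> (\<open>no_point_before_iff_Gcd_1\<close>).

  For a prime \<open>p\<close>: if \<open>p\<close> misses a coordinate, the valuation of \<open>P\<close> is \<open>0\<close>, which no point can
  undercut. If \<open>p\<close> divides all coordinates, the integral point \<open>P / p\<close> has valuation one less than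
  that of \<open>P\<close>, and \<open>P\<close> has finite valuation because it is nonzero
  (\<open>no_point_before_of_smaller_val_iff\<close>).

  Local detectability follows because an integer is \<open>1\<close> up to sign exactly if no prime divides it.\<close>

section \<open>Integral points before a point on its ray\<close>

definition before_on_ray :: "int ^ 'n \<Rightarrow> int ^ 'n \<Rightarrow> bool" where
  "before_on_ray Q P \<longleftrightarrow>
     (\<exists>r::real. 0 < r \<and> r < 1 \<and> (\<forall>i. of_int (Q $ i) = r * of_int (P $ i)))"

lemma branch_before_iff:
  assumes "0 < t" and P: "branch v t = real_of_int_vec P"
  shows "(\<exists>s. 0 < s \<and> s < t \<and> branch v s = real_of_int_vec Q) \<longleftrightarrow> before_on_ray Q P"
proof -
  have Pi: "of_int (P $ i) = t * of_rat (v $ i)" for i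
    using P by (auto simp: branch_def real_of_rat_vec_def real_of_int_vec_def vec_eq_iff)
  have on_branch: "branch v s = real_of_int_vec Q \<longleftrightarrow>
      (\<forall>i. of_int (Q $ i) = s / t * of_int (P $ i))" for s
    using \<open>0 < t\<close>
    by (auto simp: branch_def real_of_rat_vec_def real_of_int_vec_def vec_eq_iff Pi)
  show ?thesis
  proof
    assume "\<exists>s. 0 < s \<and> s < t \<and> branch v s = real_of_int_vec Q"
    then obtain s where "0 < s" "s < t" "branch v s = real_of_int_vec Q" by blast
    then show "before_on_ray Q P"
      unfolding before_on_ray_def on_branch using \<open>0 < t\<close> by (intro exI[of _ "s / t"]) auto
  next
    assume "before_on_ray Q P"
    then obtain r :: real where r: "0 < r" "r < 1" "\<forall>i. of_int (Q $ i) = r * of_int (P $ i)"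
      unfolding before_on_ray_def by blast
    then show "\<exists>s. 0 < s \<and> s < t \<and> branch v s = real_of_int_vec Q"
      unfolding on_branch using \<open>0 < t\<close> by (intro exI[of _ "r * t"]) auto
  qed
qed

lemma globally_visible_iff:
  assumes "Y \<subseteq> range branch" "P \<in> branch_locus Y"
  shows "globally_visible Y P \<longleftrightarrow> (\<nexists>Q. before_on_ray Q P)"
proof -
  have "(\<exists>s. 0 < s \<and> s < t \<and> (\<exists>Q. \<phi> s = real_of_int_vec Q)) \<longleftrightarrow> (\<exists>Q. before_on_ray Q P)"
    if "\<phi> \<in> Y" "0 < t" "\<phi> t = real_of_int_vec P" for \<phi> t
    using that assms(1) branch_before_iff by blast
  then show ?thesis
    using assms(2) unfolding globally_visible_def branch_locus_def by blast
qed

lemma padically_visible_iff: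
  assumes "Y \<subseteq> range branch" "P \<in> branch_locus Y"
  shows "padically_visible p Y P \<longleftrightarrow> (\<forall>Q. before_on_ray Q P \<longrightarrow> vec_val p P \<le> vec_val p Q)"
proof -
  have "(\<forall>s Q. 0 < s \<and> s < t \<and> \<phi> s = real_of_int_vec Q \<longrightarrow> vec_val p P \<le> vec_val p Q) \<longleftrightarrow>
      (\<forall>Q. before_on_ray Q P \<longrightarrow> vec_val p P \<le> vec_val p Q)"
    if "\<phi> \<in> Y" "0 < t" "\<phi> t = real_of_int_vec P" for \<phi> t
    using that assms(1) branch_before_iff by blast
  then show ?thesis
    using assms(2) unfolding padically_visible_def branch_locus_def by blast
qed

lemma rational_ray_datum_subset_branches: "rational_ray_datum E rep \<subseteq> range branch"
  by (auto simp: rational_ray_datum_def)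

lemma branch_locus_positive:
  assumes "chooses_representatives E rep" and P: "P \<in> branch_locus (rational_ray_datum E rep)"
  shows "0 < P $ i"
proof -
  obtain c t where c: "c \<in> positive_rational_rays E" and "0 < t"
    and eq: "branch (rep c) t = real_of_int_vec P"
    using P by (auto simp: branch_locus_def rational_ray_datum_def)
  have "rep c \<in> c"
    using assms(1) c by (auto simp: chooses_representatives_def)
  then have "rep c \<in> positive_rational_points E"
    using c by (auto simp: positive_rational_rays_def quotient_def ray_rel_def)
  then have "0 < rep c $ i"
    by (auto simp: positive_rational_points_def)
  moreover have "of_int (P $ i) = t * of_rat (rep c $ i)"
    using eq by (auto simp: branch_def real_of_rat_vec_def real_of_int_vec_def vec_eq_iff)
  ultimately have "0 < real_of_int (P $ i)"
    using \<open>0 < t\<close> by simp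
  then show ?thesis by simp
qed

text \<open>Dividing by \<open>d\<close> moves \<open>P\<close> towards the origin to another integral point. With \<open>d\<close> the gcd of the
  coordinates this point obstructs global visibility; with \<open>d\<close> a prime \<open>p\<close> it obstructs \<open>p\<close>-adic
  visibility.\<close>

lemma ex_before_on_ray_of_common_divisor:
  assumes "1 < d" and "\<forall>i. d dvd P $ i"
  obtains Q where "P = d *s Q" and "before_on_ray Q P"
proof
  let ?Q = "\<chi> i. P $ i div d"
  show eq: "P = d *s ?Q"
    using assms by (simp add: vec_eq_iff)
  have "P $ i = d * (?Q $ i)" for i
    using assms by simp
  then have "real_of_int (P $ i) = of_int d * of_int (?Q $ i)" for i
    by (metis of_int_mult)
  then show "before_on_ray ?Q P"
    unfolding before_on_ray_def using assms(1) by (intro exI[of _ "1 / of_int d"]) auto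
qed

section \<open>Global visibility and the gcd\<close>

text \<open>The ratio of \<open>Q\<close> to \<open>P\<close> is \<open>Q\<^sub>k / P\<^sub>k\<close>, whose denominator can only cancel against \<open>Q\<^sub>k\<close>, because
  the coordinates of \<open>P\<close> have no common factor; a ratio below \<open>1\<close> is thus impossible.\<close>

lemma not_before_on_ray_if_Gcd_1:
  fixes P :: "int ^ 'n::finite"
  assumes gcd: "(GCD i\<in>UNIV. P $ i) = 1" and pos: "0 < P $ k"
  shows "\<not> before_on_ray Q P"
proof
  assume "before_on_ray Q P"
  then obtain r :: real where r: "0 < r" "r < 1" and Q: "\<And>i. of_int (Q $ i) = r * of_int (P $ i)"
    unfolding before_on_ray_def by blast
  have "0 < real_of_int (Q $ k)" "real_of_int (Q $ k) < of_int (P $ k)"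
    using r pos by (simp_all add: Q)
  then have Qk: "0 < Q $ k" "Q $ k < P $ k" by simp_all
  have "P $ k dvd Q $ k * P $ i" for i
  proof -
    have "real_of_int (Q $ k * P $ i) = of_int (P $ k * Q $ i)"
      by (simp add: Q)
    then show ?thesis
      unfolding of_int_eq_iff by simp
  qed
  then have "P $ k dvd (GCD i\<in>UNIV. Q $ k * P $ i)"
    by (auto intro: Gcd_greatest)
  also have "(GCD i\<in>UNIV. Q $ k * P $ i) = normalize (Q $ k * (GCD i\<in>UNIV. P $ i))"
    using Gcd_mult[of "Q $ k" "range (($) P)"] by (simp add: image_image)
  also have "\<dots> = Q $ k"
    using gcd Qk by simp
  finally show False
    using Qk zdvd_imp_le by fastforce
qed

lemma no_point_before_iff_Gcd_1:
  fixes P :: "int ^ 'n::finite"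
  assumes pos: "\<And>i. 0 < P $ i"
  shows "(\<nexists>Q. before_on_ray Q P) \<longleftrightarrow> (GCD i\<in>UNIV. P $ i) = 1"
proof
  let ?g = "GCD i\<in>UNIV. P $ i"
  have g: "\<forall>i. ?g dvd P $ i" by (auto intro: Gcd_dvd)
  assume none: "\<nexists>Q. before_on_ray Q P"
  have "?g \<noteq> 0" using g pos by (metis dvd_0_left_iff less_irrefl)
  moreover have "0 \<le> ?g" by (rule Gcd_int_greater_eq_0)
  moreover have "\<not> 1 < ?g"
    using none g ex_before_on_ray_of_common_divisor by metis
  ultimately show "?g = 1" by linarith
qed (use not_before_on_ray_if_Gcd_1 pos in blast)

section \<open>Visibility at a prime\<close>

text \<open>This is an equation in \<^typ>\<open>enat\<close>: since \<^prop>\<open>eSuc \<infinity> = \<infinity>\<close>, it covers \<^prop>\<open>a = 0\<close>, so that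
  the version for vectors holds with zero coordinates as well.\<close>

lemma val_times_prime:
  assumes "prime p"
  shows "val p (int p * a) = eSuc (val p a)"
proof (cases "a = 0")
  case False
  then show ?thesis
    using assms prime_gt_1_nat[OF assms]
    by (simp add: val_def multiplicity_times_same eSuc_enat)
qed (simp add: val_def)

lemma vec_val_times_prime:
  assumes "prime p"
  shows "vec_val p (int p *s Q) = eSuc (vec_val p Q)"
proof -
  have "eSuc (Min (range (\<lambda>i. val p (Q $ i)))) = Min (eSuc ` range (\<lambda>i. val p (Q $ i)))"
    by (rule mono_Min_commute) (auto simp: mono_def)
  then show ?thesis
    by (simp add: vec_val_def val_times_prime[OF assms] image_image)
qed

lemma vec_val_le: "vec_val p P \<le> val p (P $ i)"
  by (simp add: vec_val_def)

lemma no_point_before_of_smaller_val_iff: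
  fixes P :: "int ^ 'n::finite"
  assumes p: "prime p" and pos: "0 < P $ k"
  shows "(\<forall>Q. before_on_ray Q P \<longrightarrow> vec_val p P \<le> vec_val p Q) \<longleftrightarrow> \<not> (\<forall>i. int p dvd P $ i)"
proof (cases "\<forall>i. int p dvd P $ i")
  case True
  moreover have "1 < int p"
    using prime_gt_1_nat[OF p] by simp
  ultimately obtain Q where PQ: "P = int p *s Q" and Q: "before_on_ray Q P"
    using ex_before_on_ray_of_common_divisor by metis
  have "vec_val p Q < vec_val p P"
  proof -
    have "vec_val p P \<noteq> \<infinity>"
      using vec_val_le[of p P k] pos by (auto simp: val_def dest: enat_ile)
    then show ?thesis
      unfolding PQ vec_val_times_prime[OF p] by (cases "vec_val p Q") (auto simp: eSuc_enat)
  qed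
  then show ?thesis
    using True Q by (meson not_le)
next
  case False
  then obtain i where "\<not> int p dvd P $ i" by blast
  then have "val p (P $ i) = 0"
    by (auto simp: val_def not_dvd_imp_multiplicity_0 zero_enat_def)
  then have "vec_val p P = 0"
    using vec_val_le[of p P i] by simp
  then show ?thesis
    using False by simp
qed

section \<open>Local detectability\<close>

lemma Gcd_eq_1_iff_no_prime_dvd:
  fixes P :: "int ^ 'n::finite"
  shows "(GCD i\<in>UNIV. P $ i) = 1 \<longleftrightarrow> (\<forall>p. prime p \<longrightarrow> \<not> (\<forall>i. int p dvd P $ i))"
proof -
  let ?g = "GCD i\<in>UNIV. P $ i"
  have dvd_iff: "int p dvd ?g \<longleftrightarrow> (\<forall>i. int p dvd P $ i)" for p
    by (auto simp: dvd_Gcd_iff)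
  have "0 \<le> ?g" by (rule Gcd_int_greater_eq_0)
  then have "?g = 1 \<longleftrightarrow> nat ?g = 1" by auto
  also have "\<dots> \<longleftrightarrow> (\<forall>p. prime p \<longrightarrow> \<not> p dvd nat ?g)"
    using prime_factor_nat by (metis not_prime_unit)
  also have "\<dots> \<longleftrightarrow> (\<forall>p. prime p \<longrightarrow> \<not> int p dvd ?g)"
    using \<open>0 \<le> ?g\<close> by (metis int_dvd_int_iff int_nat_eq)
  finally show ?thesis
    unfolding dvd_iff .
qed

theorem proposition4p7:
  fixes E :: "'n::finite rat_mpoly set"
    and rep :: "(rat ^ 'n) set \<Rightarrow> rat ^ 'n"
  assumes "\<forall>f\<in>E. homogeneous f"
    and "positive_rational_points E \<noteq> {}"
    and "chooses_representatives E rep"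
  shows "(\<forall>P\<in>branch_locus (rational_ray_datum E rep).
            (globally_visible (rational_ray_datum E rep) P \<longleftrightarrow> (GCD i\<in>UNIV. P $ i) = 1) \<and>
            (\<forall>p. prime p \<longrightarrow>
               (padically_visible p (rational_ray_datum E rep) P \<longleftrightarrow> \<not> (\<forall>i. int p dvd P $ i)))) \<and>
         locally_detectable (rational_ray_datum E rep)"
proof -
  let ?Y = "rational_ray_datum E rep"
  have glob: "globally_visible ?Y P \<longleftrightarrow> (GCD i\<in>UNIV. P $ i) = 1" if "P \<in> branch_locus ?Y" for P
    using globally_visible_iff[OF rational_ray_datum_subset_branches that]
      no_point_before_iff_Gcd_1[of P] branch_locus_positive[OF assms(3) that] by simp
  have loc: "padically_visible p ?Y P \<longleftrightarrow> \<not> (\<forall>i. int p dvd P $ i)"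
    if "P \<in> branch_locus ?Y" "prime p" for P p
    using padically_visible_iff[OF rational_ray_datum_subset_branches that(1)]
      no_point_before_of_smaller_val_iff[OF that(2), of P]
      branch_locus_positive[OF assms(3) that(1)] by simp
  have "locally_detectable ?Y"
    unfolding locally_detectable_def using glob loc Gcd_eq_1_iff_no_prime_dvd by metis
  then show ?thesis
    using glob loc by blast
qed

end
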